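(* Let $g(z)=\sum_{n=0}^{\infty} g_n z^n$ be a power series converging for $|z|<R$, where $R>1$. For an integer $\ell\ge 0$ put $g_\ell(z)=\sum_{n=0}^{\infty} g_{n+\ell}z^n$, and for an integer $k\ge 1$ define $$G_{k,\ell}(x_1,\ldots,x_k)=\sum_{n_1=0}^{\infty}\cdots\sum_{n_k=0}^{\infty} g_{n_1+\cdots+n_k+\ell}\; x_1^{n_1}\cdots x_k^{n_k}\qquad (|x_1|,\ldots,|x_k|<R).$$ Let $k,j$ be integers with $1\le j\le k$, let $\ell\ge 0$ be an integer, and let $i_1,\ldots,i_j\in\{1,\ldots,k\}$ be pairwise different integers. Then, for every $x$ with $|x|<R$, $$\lim_{x_1,\ldots,x_k\to x}\frac{\partial^{j}}{\partial x_{i_1}\cdots\partial x_{i_j}}G_{k,\ell}(x_1,\ldots,x_k)=\frac{1}{(k+j-1)!}\left.\left[\left(\frac{d}{dz}\right)^{k+j-1}\bigl(z^{k-1}g_\ell(z)\bigr)\right]\right|_{z=x}.$$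
   Context: The limit is taken as all of the variables $x_1,\ldots,x_k$ tend jointly to the common point $x$. *)

theory Defs
  imports "HOL-Analysis.Analysis"
begin

definition shift_series :: "(nat \<Rightarrow> complex) \<Rightarrow> nat \<Rightarrow> complex \<Rightarrow> complex" where
  "shift_series g l z = (\<Sum>n. g (n + l) * z ^ n)"

text \<open>
  The \<open>k\<close> variables are indexed by a finite type with \<open>k\<close> elements, and a
  multi-index \<open>(n\<^sub>1, \<dots>, n\<^sub>k)\<close> is a function from this type to the
  naturals.  If \<open>g\<close> has radius of convergence at least \<open>R\<close>, the \<open>k\<close>-fold series converges
  absolutely on the polydisc of radius \<open>R\<close>, so that the unordered sum and the iterated sum
  agree there; outside the domain of convergence the value is a dummy.
\<close>

definition multi_series :: "(nat \<Rightarrow> complex) \<Rightarrow> nat \<Rightarrow> complex ^ 'k \<Rightarrow> complex" where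
  "multi_series g l v =
     (\<Sum>\<^sub>\<infinity>n\<in>(UNIV :: ('k::finite \<Rightarrow> nat) set). g ((\<Sum>i\<in>UNIV. n i) + l) * (\<Prod>i\<in>UNIV. (v $ i) ^ n i))"

definition partial_deriv :: "'k \<Rightarrow> (complex ^ 'k \<Rightarrow> complex) \<Rightarrow> complex ^ 'k \<Rightarrow> complex" where
  "partial_deriv i f v = deriv (\<lambda>t. f (\<chi> m. if m = i then t else v $ m)) (v $ i)"

text \<open>
  For a list \<open>[i\<^sub>1, \<dots>, i\<^sub>j]\<close>, the derivative with respect to the last
  listed variable is taken first, as in
  \<open>(\<partial>/\<partial>x\<^sub>i\<^sub>1) (\<dots> (\<partial>/\<partial>x\<^sub>i\<^sub>j) f)\<close>.
\<close>

definition iter_partial_deriv ::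
  "'k list \<Rightarrow> (complex ^ 'k \<Rightarrow> complex) \<Rightarrow> complex ^ 'k \<Rightarrow> complex" where
  "iter_partial_deriv idx f = foldr partial_deriv idx f"

end

theory Submission
  imports Defs
begin

text \<open>
  On the open polydisc the \<open>k\<close>-fold series may be differentiated term by term, and the
  differentiated series converge locally uniformly, so the limit is the value at \<open>(x, \<dots>, x)\<close>.
  There the terms are grouped by total degree \<open>N\<close>: the inner sum is the coefficient of
  \<open>X\<^sup>N\<close> in \<open>X\<^sup>j / (1 - x X)\<^sup>k\<^sup>+\<^sup>j\<close>, a binomial
  coefficient times \<open>x\<^sup>N\<^sup>-\<^sup>j\<close>, which is also what \<open>k + j - 1\<close> derivatives
  of \<open>z\<^sup>N\<^sup>+\<^sup>k\<^sup>-\<^sup>1\<close> produce.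
\<close>

section \<open>Differentiated monomials and multi-index summability\<close>

definition power_deriv :: "bool \<Rightarrow> nat \<Rightarrow> complex \<Rightarrow> complex" where
  "power_deriv b n t = (if b then of_nat n * t ^ (n - 1) else t ^ n)"

text \<open>A set \<open>S\<close> suffices to record the derivatives taken: for distinct indices
  each variable is differentiated at most once, and the order leaves no trace in the termwise
  result.\<close>

definition deriv_series ::
  "(nat \<Rightarrow> complex) \<Rightarrow> nat \<Rightarrow> 'k set \<Rightarrow> complex ^ 'k \<Rightarrow> complex" where
  "deriv_series g l S v =
     (\<Sum>\<^sub>\<infinity>n\<in>(UNIV :: ('k::finite \<Rightarrow> nat) set).
        g ((\<Sum>i\<in>UNIV. n i) + l) * (\<Prod>i\<in>UNIV. power_deriv (i \<in> S) (n i) (v $ i)))"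

lemma multi_series_eq_deriv_series: "multi_series g l = deriv_series g l {}"
  by (simp add: fun_eq_iff multi_series_def deriv_series_def power_deriv_def)

lemma norm_power_deriv_le:
  assumes "norm t \<le> r" "1 \<le> r"
  shows "norm (power_deriv b n t) \<le> real (n + 1) * r ^ n"
proof (cases b)
  case True
  have "norm t ^ (n - 1) \<le> r ^ (n - 1)"
    using assms by (intro power_mono) auto
  also have "\<dots> \<le> r ^ n"
    using assms by (intro power_increasing) auto
  finally have "real n * norm t ^ (n - 1) \<le> real (n + 1) * r ^ n"
    using assms by (intro mult_mono) auto
  with True show ?thesis
    by (simp add: power_deriv_def norm_mult norm_power)
next
  case False
  have "norm t ^ n \<le> r ^ n"
    using assms by (intro power_mono) auto
  also have "\<dots> \<le> real (n + 1) * r ^ n"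
    using assms by (simp add: mult_le_cancel_right1)
  finally show ?thesis
    using False by (simp add: power_deriv_def norm_power)
qed

text \<open>Multiplying out a finite product of absolutely convergent series reduces summability
  over multi-indices to one variable.\<close>

lemma summable_on_prod_UNIV:
  fixes f :: "'k::finite \<Rightarrow> nat \<Rightarrow> real"
  assumes "\<And>i n. f i n \<ge> 0" "\<And>i. summable (f i)"
  shows "(\<lambda>n. \<Prod>i\<in>UNIV. f i (n i)) summable_on UNIV"
proof -
  have "Infinite_Set_Sum.abs_summable_on (\<lambda>n. \<Prod>i\<in>UNIV. f i (n i)) (PiE UNIV (\<lambda>_. UNIV))"
    using assms by (intro abs_summable_on_prod_PiE) (auto simp: abs_summable_on_nat_iff')
  then have "(\<lambda>n. norm (\<Prod>i\<in>UNIV. f i (n i))) summable_on UNIV"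
    by (simp flip: abs_summable_equivalent)
  then show ?thesis
    by (rule abs_summable_summable)
qed

section \<open>Sums over multi-indices of fixed total degree\<close>

lemma count_bij_betw_multisets_of_size:
  "bij_betw count (multisets_of_size (UNIV :: 'k::finite set) N) {n. (\<Sum>i\<in>UNIV. n i) = N}"
proof (rule bij_betw_byWitness[where f' = Abs_multiset])
  show "\<forall>X\<in>multisets_of_size UNIV N. Abs_multiset (count X) = X"
    by (simp add: count_inverse)
  show "\<forall>n\<in>{n. (\<Sum>i\<in>UNIV. n i) = N}. count (Abs_multiset n) = (n :: 'k \<Rightarrow> nat)"
    by (simp add: Abs_multiset_inverse)
  have size: "(\<Sum>i\<in>UNIV. count X i) = size X" for X :: "'k multiset"
    unfolding size_multiset_overloaded_eq by (rule sum.mono_neutral_right) (auto simp: not_in_iff)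
  show "count ` multisets_of_size (UNIV :: 'k set) N \<subseteq> {n. (\<Sum>i\<in>UNIV. n i) = N}"
    by (auto simp: multisets_of_size_def size)
  show "Abs_multiset ` {n. (\<Sum>i\<in>UNIV. n i) = N} \<subseteq> multisets_of_size (UNIV :: 'k set) N"
    by (auto simp: multisets_of_size_def Abs_multiset_inverse simp flip: size)
qed

text \<open>The product formula for formal power series sums over multisets of size
  \<open>N\<close>; their multiplicity functions are the multi-indices of degree
  \<open>N\<close>.\<close>

lemma fps_nth_prod_UNIV:
  fixes f :: "'k::finite \<Rightarrow> 'a::comm_ring_1 fps"
  shows "fps_nth (\<Prod>i\<in>UNIV. f i) N = (\<Sum>n | (\<Sum>i\<in>UNIV. n i) = N. \<Prod>i\<in>UNIV. fps_nth (f i) (n i))"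
  by (subst fps_prod_nth') (simp_all add: sum.reindex_bij_betw[OF count_bij_betw_multisets_of_size,
        of "\<lambda>n. \<Prod>i\<in>UNIV. fps_nth (f i) (n i)", symmetric])

text \<open>For \<open>b\<close> false this is the geometric series; for \<open>b\<close> true it is
  the expansion of the inverse square, shifted by one place. The formal variable
  \<open>fps_X\<close> counts degrees, so \<open>x\<close> is arbitrary.\<close>

lemma Abs_fps_power_deriv:
  "Abs_fps (\<lambda>n. power_deriv b n x) =
     fps_X ^ of_bool b * inverse ((1 - fps_const x * fps_X) ^ (1 + of_bool b))"
proof -
  have "of_nat n * x ^ (n - 1) =
      (if n = 0 then 0 else of_nat (Suc (n - 1) choose (n - 1)) * x ^ (n - 1))" for n
    by (cases n) auto
  then show ?thesis
    by (cases b)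
      (auto simp: fps_eq_iff power_deriv_def one_minus_const_fps_X_neg_power'[of 2, simplified]
        one_minus_const_fps_X_neg_power'[of 1, simplified] numeral_2_eq_2[symmetric])
qed

lemma sum_prod_power_deriv:
  fixes S :: "'k::finite set"
  shows "(\<Sum>n | (\<Sum>i\<in>UNIV. n i) = N. \<Prod>i\<in>UNIV. power_deriv (i \<in> S) (n i) x) =
     (if N < card S then 0
      else of_nat ((CARD('k) + card S + (N - card S) - 1) choose (N - card S)) * x ^ (N - card S))"
proof -
  let ?q = "1 - fps_const x * fps_X"
  have card: "(\<Sum>i\<in>(UNIV :: 'k set). of_bool (i \<in> S)) = card S"
    by simp
  have "(\<Sum>n | (\<Sum>i\<in>UNIV. n i) = N. \<Prod>i\<in>UNIV. power_deriv (i \<in> S) (n i) x) =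
      fps_nth (\<Prod>i\<in>UNIV. Abs_fps (\<lambda>n. power_deriv (i \<in> S) n x)) N"
    by (simp add: fps_nth_prod_UNIV)
  \<comment> \<open>Every variable contributes \<open>1 / (1 - x X)\<close>, and every variable in
    \<open>S\<close> a further \<open>X / (1 - x X)\<close>.\<close>
  also have "(\<Prod>i\<in>UNIV. Abs_fps (\<lambda>n. power_deriv (i \<in> S) n x)) =
      fps_X ^ card S * inverse (?q ^ (CARD('k) + card S))"
    by (simp only: Abs_fps_power_deriv prod.distrib fps_inverse_power power_sum[symmetric]
        sum.distrib card) simp
  finally show ?thesis
    by (simp add: one_minus_const_fps_X_neg_power' fps_X_power_mult_nth)
qed

section \<open>Derivatives of convergent power series, and locality of partial derivatives\<close>

lemma fps_nth_higher_deriv: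
  fixes f :: "complex fps"
  shows "fps_nth ((fps_deriv ^^ m) f) n = fact (n + m) / fact n * fps_nth f (n + m)"
proof (induction m arbitrary: n)
  case (Suc m)
  have "fps_nth ((fps_deriv ^^ Suc m) f) n =
      of_nat (Suc n) * (fact (Suc n + m) / fact (Suc n) * fps_nth f (Suc n + m))"
    by (simp add: Suc.IH del: of_nat_Suc fact_Suc)
  also have "\<dots> = fact (n + Suc m) / fact n * fps_nth f (n + Suc m)"
    by (simp add: field_simps del: of_nat_Suc)
  finally show ?case .
qed simp

lemma higher_deriv_eval_fps:
  fixes f :: "complex fps"
  assumes "norm z < fps_conv_radius f"
  shows "norm z < fps_conv_radius ((fps_deriv ^^ m) f)"
    and "(deriv ^^ m) (eval_fps f) z = eval_fps ((fps_deriv ^^ m) f) z"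
proof -
  have radius: "fps_conv_radius ((fps_deriv ^^ m) f) \<ge> fps_conv_radius f" for m
    by (induction m) (auto intro: order_trans fps_conv_radius_deriv)
  then show "norm z < fps_conv_radius ((fps_deriv ^^ m) f)"
    using assms less_le_trans by blast
  show "(deriv ^^ m) (eval_fps f) z = eval_fps ((fps_deriv ^^ m) f) z"
    using assms
  proof (induction m arbitrary: z)
    case (Suc m)
    \<comment> \<open>\<open>deriv\<close> depends on a whole neighbourhood of \<open>z\<close>, so
      the induction hypothesis is applied throughout the open disc of convergence.\<close>
    have "\<forall>\<^sub>F w in nhds z. w \<in> eball 0 (fps_conv_radius f)"
      using Suc.prems by (intro eventually_nhds_in_open) auto
    then have "\<forall>\<^sub>F w in nhds z. (deriv ^^ m) (eval_fps f) w = eval_fps ((fps_deriv ^^ m) f) w"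
      by eventually_elim (simp add: Suc.IH)
    then have "(deriv ^^ Suc m) (eval_fps f) z = deriv (eval_fps ((fps_deriv ^^ m) f)) z"
      by (simp add: deriv_cong_ev)
    also have "\<dots> = eval_fps ((fps_deriv ^^ Suc m) f) z"
      using Suc.prems radius[of m] by (simp add: eval_fps_deriv less_le_trans)
    finally show ?case .
  qed simp
qed

text \<open>Serves inside iterated derivatives: the series is controlled only on the polydisc, and a
  small change of one coordinate stays inside it.\<close>

lemma partial_deriv_cong_polydisc:
  assumes "\<And>w. (\<And>m. norm (w $ m) < R) \<Longrightarrow> f w = h w" and "\<And>m. norm (v $ m) < R"
  shows "partial_deriv i f v = partial_deriv i h v"
proof -
  have "\<forall>\<^sub>F t in nhds (v $ i). t \<in> ball 0 R"
    using assms(2) by (intro eventually_nhds_in_open) auto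
  then have "\<forall>\<^sub>F t in nhds (v $ i).
      f (\<chi> m. if m = i then t else v $ m) = h (\<chi> m. if m = i then t else v $ m)"
    by eventually_elim (auto intro!: assms(1) simp: assms(2))
  then show ?thesis
    unfolding partial_deriv_def by (intro deriv_cong_ev refl)
qed

section \<open>Absolute convergence on the polydisc\<close>

locale power_series_on_disc =
  fixes g :: "nat \<Rightarrow> complex" and R :: real
  assumes R_gt_1: "R > 1"
    and summable_g: "norm z < R \<Longrightarrow> summable (\<lambda>n. g n * z ^ n)"
begin

text \<open>
  The factor \<open>n i + 1\<close> makes one majorant serve all the differentiated series, because
  \<open>n i * r ^ (n i - 1) \<le> (n i + 1) * r ^ n i\<close> for \<open>r \<ge> 1\<close>; such an
  \<open>r\<close> exists below \<open>R\<close> since \<open>R > 1\<close>.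
\<close>

definition majorant :: "nat \<Rightarrow> real \<Rightarrow> ('k::finite \<Rightarrow> nat) \<Rightarrow> real" where
  "majorant l r n = norm (g ((\<Sum>i\<in>UNIV. n i) + l)) * (\<Prod>i\<in>UNIV. real (n i + 1) * r ^ n i)"

text \<open>Convergence at an intermediate radius \<open>s\<close> bounds
  \<open>g (n + l) * s ^ n\<close> by a constant \<open>C\<close>. With
  \<open>q = r / s < 1\<close>, the majorant is at most \<open>C\<close> times the product of the
  factors \<open>(n i + 1) * q ^ n i\<close>, each the term of a convergent series.\<close>

lemma majorant_summable:
  assumes "1 \<le> r" "r < R"
  shows "(majorant l r :: ('k::finite \<Rightarrow> nat) \<Rightarrow> real) summable_on UNIV"
proof -
  obtain s where s: "r < s" "s < R"
    using assms dense by blast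
  with assms have pos: "0 < s" by simp
  have "summable (\<lambda>n. g n * complex_of_real s ^ n)"
    using s pos by (intro summable_g) simp
  then have "summable (\<lambda>n. g (n + l) * complex_of_real s ^ n)"
    by (simp add: summable_powser_ignore_initial_segment)
  then have "Bseq (\<lambda>n. g (n + l) * complex_of_real s ^ n)"
    by (intro convergent_imp_Bseq) (auto simp: convergent_def dest: summable_LIMSEQ_zero)
  then obtain C where C: "\<And>n. norm (g (n + l) * complex_of_real s ^ n) \<le> C"
    by (auto simp: Bseq_def)
  define q where "q = r / s"
  have q: "0 \<le> q" "q < 1"
    using assms s pos by (auto simp: q_def)
  have rq: "r = s * q"
    using pos by (simp add: q_def)
  have bound: "majorant l r n \<le> C * (\<Prod>i\<in>UNIV. real (n i + 1) * q ^ n i)" for n :: "'k \<Rightarrow> nat"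
  proof -
    have "majorant l r n = norm (g ((\<Sum>i\<in>UNIV. n i) + l) * complex_of_real s ^ (\<Sum>i\<in>UNIV. n i)) *
        (\<Prod>i\<in>UNIV. real (n i + 1) * q ^ n i)"
      using pos by (simp add: majorant_def rq norm_mult norm_power power_mult_distrib prod.distrib
          power_sum prod_norm [symmetric] mult_ac)
    also have "\<dots> \<le> C * (\<Prod>i\<in>UNIV. real (n i + 1) * q ^ n i)"
      using q by (intro mult_right_mono C prod_nonneg) auto
    finally show ?thesis .
  qed
  have "summable (\<lambda>n. real (Suc n) * q ^ n)"
    using geometric_deriv_sums[of q] q by (auto simp: sums_iff)
  then have "(\<lambda>n. \<Prod>i\<in>(UNIV :: 'k set). real (n i + 1) * q ^ n i) summable_on UNIV"
    using q by (intro summable_on_prod_UNIV) auto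
  then have "(\<lambda>n. C * (\<Prod>i\<in>(UNIV :: 'k set). real (n i + 1) * q ^ n i)) summable_on UNIV"
    by (rule summable_on_cmult_right)
  then show ?thesis
    by (rule summable_on_comparison_test)
      (use bound assms in \<open>auto simp: majorant_def intro!: mult_nonneg_nonneg prod_nonneg\<close>)
qed

lemma term_le_majorant:
  assumes "1 \<le> r" "\<And>i. norm (v $ i) \<le> r"
  shows "norm (g ((\<Sum>i\<in>UNIV. n i) + l) * (\<Prod>i\<in>UNIV. power_deriv (i \<in> S) (n i) (v $ i)))
      \<le> majorant l r n"
  unfolding majorant_def norm_mult prod_norm[symmetric]
  using assms by (intro mult_left_mono prod_mono conjI norm_power_deriv_le) auto

lemma polydisc_radius:
  fixes v :: "complex ^ 'k::finite"
  assumes "\<And>i. norm (v $ i) < R"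
  obtains r where "1 \<le> r" "r < R" "\<And>i. norm (v $ i) < r"
proof -
  \<comment> \<open>Including 1 in the maximum secures \<open>1 \<le> r\<close>, as the majorant
    requires; \<open>R > 1\<close> keeps the maximum below \<open>R\<close>.\<close>
  define m where "m = Max (insert 1 (range (\<lambda>i. norm (v $ i))))"
  have "m < R"
    using assms R_gt_1 by (auto simp: m_def)
  then obtain r where r: "m < r" "r < R"
    using dense by blast
  have "norm (v $ i) \<le> m" "1 \<le> m" for i
    unfolding m_def by (rule Max_ge; simp)+
  with r show ?thesis
    by (intro that[of r]) (auto intro: le_less_trans)
qed

lemma deriv_series_summable:
  assumes "\<And>i. norm (v $ i) < R"
  shows "(\<lambda>n. g ((\<Sum>i\<in>UNIV. n i) + l) * (\<Prod>i\<in>UNIV. power_deriv (i \<in> S) (n i) (v $ i)))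
    summable_on UNIV"
proof -
  obtain r where r: "1 \<le> r" "r < R" "\<And>i. norm (v $ i) < r"
    using polydisc_radius[of v] assms by blast
  have "(\<lambda>n. norm (g ((\<Sum>i\<in>UNIV. n i) + l) * (\<Prod>i\<in>UNIV. power_deriv (i \<in> S) (n i) (v $ i))))
      summable_on UNIV"
    by (rule Infinite_Sum.abs_summable_on_comparison_test'[OF majorant_summable[of r l] term_le_majorant])
      (use r in \<open>auto intro: less_imp_le\<close>)
  then show ?thesis
    by (rule abs_summable_summable)
qed

section \<open>Termwise partial differentiation\<close>

lemma deriv_series_sums:
  fixes e :: "nat \<Rightarrow> 'k::finite \<Rightarrow> nat"
  assumes "\<And>i. norm (v $ i) < R" and "bij e"
  shows "(\<lambda>a. g ((\<Sum>i\<in>UNIV. e a i) + l) * (\<Prod>i\<in>UNIV. power_deriv (i \<in> S) (e a i) (v $ i)))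
    sums deriv_series g l S v"
  using has_sum_infsum[OF deriv_series_summable[of v l S]] assms
  by (intro has_sum_imp_sums) (simp add: has_sum_reindex_bij_betw[of e, symmetric] deriv_series_def)

text \<open>With the other coordinates frozen, each term is a constant times a power of one variable
  \<open>t\<close>. The termwise derivatives converge uniformly near \<open>v $ i\<close>, so
  differentiation passes under the sum.\<close>

lemma partial_deriv_deriv_series:
  fixes v :: "complex ^ 'k::finite"
  assumes v: "\<And>m. norm (v $ m) < R" and i: "i \<notin> S"
  shows "partial_deriv i (deriv_series g l S) v = deriv_series g l (insert i S) v"
proof -
  obtain r where r: "1 \<le> r" "r < R" "\<And>m. norm (v $ m) < r"
    using polydisc_radius[of v] v by blast
  \<comment> \<open>Enumerating the multi-indices turns the unordered sum into an ordinary series,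
    to which the theorem on differentiating a series of functions applies.\<close>
  define e :: "nat \<Rightarrow> 'k \<Rightarrow> nat" where "e = from_nat_into UNIV"
  have "infinite (UNIV :: ('k \<Rightarrow> nat) set)"
    by (simp add: finite_UNIV_fun)
  then have e: "bij e"
    unfolding e_def by (intro bij_betw_from_nat_into) auto
  define w where "w t = (\<chi> m. if m = i then t else v $ m)" for t
  have w: "norm (w t $ m) < r" if "t \<in> ball 0 r" for t m
    using r that by (simp add: w_def)
  define F where "F T a t = g ((\<Sum>m\<in>UNIV. e a m) + l) *
      (\<Prod>m\<in>UNIV. power_deriv (m \<in> T) (e a m) (w t $ m))" for T a t
  have sums: "(\<lambda>a. F T a t) sums deriv_series g l T (w t)" if "t \<in> ball 0 r" for T t
    unfolding F_def using w[OF that] r e by (intro deriv_series_sums) (auto intro: less_trans)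
  \<comment> \<open>The factors of index other than \<open>i\<close> do not depend on
    \<open>t\<close> and agree for \<open>S\<close> and \<open>insert i S\<close>; as
    \<open>i \<notin> S\<close>, the remaining factor in \<open>F S\<close> is a plain
    power.\<close>
  define c where "c a = g ((\<Sum>m\<in>UNIV. e a m) + l) *
      (\<Prod>m\<in>UNIV-{i}. power_deriv (m \<in> S) (e a m) (v $ m))" for a
  have F: "F S a t = c a * t ^ e a i" "F (insert i S) a t = c a * (of_nat (e a i) * t ^ (e a i - 1))"
    for a t
  proof -
    have "(\<Prod>m\<in>UNIV-{i}. power_deriv (m \<in> insert i S) (e a m) (w t $ m)) =
        (\<Prod>m\<in>UNIV-{i}. power_deriv (m \<in> S) (e a m) (v $ m))"
      "(\<Prod>m\<in>UNIV-{i}. power_deriv (m \<in> S) (e a m) (w t $ m)) =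
        (\<Prod>m\<in>UNIV-{i}. power_deriv (m \<in> S) (e a m) (v $ m))"
      by (auto simp: w_def intro!: prod.cong)
    then show "F S a t = c a * t ^ e a i"
        "F (insert i S) a t = c a * (of_nat (e a i) * t ^ (e a i - 1))"
      unfolding F_def c_def prod.remove[OF finite UNIV_I[of i]]
      using i by (simp_all add: power_deriv_def w_def mult_ac)
  qed
  have majorant: "summable (\<lambda>a. majorant l r (e a))"
    using majorant_summable[of r l] r e
    by (intro summable_on_imp_summable) (simp add: summable_on_reindex_bij_betw)
  have "((\<lambda>t. \<Sum>a. F S a t) has_field_derivative (\<Sum>a. F (insert i S) a (v $ i))) (at (v $ i))"
  proof (rule has_field_derivative_series'(2)[of "ball 0 r"])
    show "(F S a has_field_derivative F (insert i S) a t) (at t within ball 0 r)" for a t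
      unfolding F by (auto intro!: derivative_eq_intros)
    \<comment> \<open>Weierstrass M-test: for \<open>t\<close> in the ball all coordinates of
      \<open>w t\<close> have norm below \<open>r\<close>, so one majorant serves every
      \<open>t\<close>.\<close>
    show "uniformly_convergent_on (ball 0 r) (\<lambda>n t. \<Sum>a<n. F (insert i S) a t)"
      unfolding F_def
      by (rule Weierstrass_m_test'[OF term_le_majorant majorant]) (use w r in \<open>auto intro: less_imp_le\<close>)
    show "v $ i \<in> ball 0 r" "v $ i \<in> interior (ball 0 r)"
      using r by auto
    then show "summable (\<lambda>a. F S a (v $ i))"
      using sums by (auto simp: sums_iff)
  qed simp
  moreover have "\<forall>\<^sub>F t in nhds (v $ i). t \<in> ball 0 r"
    using r by (intro eventually_nhds_in_open) auto
  then have "\<forall>\<^sub>F t in nhds (v $ i). (\<Sum>a. F S a t) = deriv_series g l S (w t)"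
    by eventually_elim (use sums in \<open>auto simp: sums_iff\<close>)
  ultimately have "deriv (\<lambda>t. deriv_series g l S (w t)) (v $ i) = (\<Sum>a. F (insert i S) a (v $ i))"
    by (auto intro!: DERIV_imp_deriv simp: DERIV_cong_ev)
  also have "\<dots> = deriv_series g l (insert i S) (w (v $ i))"
    using sums[of "v $ i" "insert i S"] r by (auto simp: sums_iff)
  also have "w (v $ i) = v"
    by (simp add: w_def vec_eq_iff)
  finally show ?thesis
    by (simp add: partial_deriv_def w_def)
qed

text \<open>Induction from the innermost derivative outwards. Distinctness makes each new index
  fresh, and the induction hypothesis holds on the whole polydisc, so it may be
  differentiated.\<close>

lemma iter_partial_deriv_multi_series:
  fixes v :: "complex ^ 'k::finite"
  assumes "distinct idx" "\<And>m. norm (v $ m) < R"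
  shows "iter_partial_deriv idx (multi_series g l) v = deriv_series g l (set idx) v"
  using assms
proof (induction idx arbitrary: v)
  case Nil
  then show ?case
    by (simp add: iter_partial_deriv_def multi_series_eq_deriv_series)
next
  case (Cons i idx)
  have "iter_partial_deriv (i # idx) (multi_series g l) v =
      partial_deriv i (iter_partial_deriv idx (multi_series g l)) v"
    by (simp add: iter_partial_deriv_def)
  also have "\<dots> = partial_deriv i (deriv_series g l (set idx)) v"
    using Cons by (intro partial_deriv_cong_polydisc[of R]) auto
  also have "\<dots> = deriv_series g l (set (i # idx)) v"
    using Cons.prems by (simp add: partial_deriv_deriv_series)
  finally show ?case .
qed

section \<open>Continuity of the differentiated series\<close>

lemma open_polydisc: "open {v :: complex ^ 'k::finite. \<forall>i. norm (v $ i) < r}"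
proof -
  have "{v :: complex ^ 'k. \<forall>i. norm (v $ i) < r} = (\<Inter>i. {v. norm (v $ i) < r})"
    by auto
  then show ?thesis
    by (auto intro!: open_INT open_Collect_less continuous_intros)
qed

text \<open>The finite partial sums are polynomials in the coordinates and converge uniformly by the
  M-test for unordered sums. Each point of the full polydisc lies in such a smaller one.\<close>

lemma continuous_on_deriv_series:
  assumes "1 \<le> r" "r < R"
  shows "continuous_on {v :: complex ^ 'k::finite. \<forall>i. norm (v $ i) < r} (deriv_series g l S)"
proof (rule uniform_limit_theorem)
  let ?f = "\<lambda>n v. g ((\<Sum>i\<in>UNIV. n i) + l) * (\<Prod>i\<in>UNIV. power_deriv (i \<in> S) (n i) (v $ i))"
  show "uniform_limit {v :: complex ^ 'k. \<forall>i. norm (v $ i) < r} (\<lambda>X v. \<Sum>n\<in>X. ?f n v)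
      (deriv_series g l S) (finite_subsets_at_top UNIV)"
    unfolding deriv_series_def [abs_def]
    using assms
    by (intro Weierstrass_m_test_general[OF term_le_majorant[of r]] majorant_summable)
      (auto intro: less_imp_le)
  show "\<forall>\<^sub>F X in finite_subsets_at_top UNIV.
      continuous_on {v :: complex ^ 'k. \<forall>i. norm (v $ i) < r} (\<lambda>v. \<Sum>n\<in>X. ?f n v)"
  proof (intro always_eventually allI continuous_intros)
    show "continuous_on A (\<lambda>v. power_deriv (i \<in> S) m (v $ i))" for i m and A :: "(complex ^ 'k) set"
      by (cases "i \<in> S") (auto simp: power_deriv_def intro!: continuous_intros)
  qed
qed simp

lemma isCont_deriv_series:
  fixes v :: "complex ^ 'k::finite"
  assumes "\<And>i. norm (v $ i) < R"
  shows "isCont (deriv_series g l S) v"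
proof -
  obtain r where "1 \<le> r" "r < R" "\<And>i. norm (v $ i) < r"
    using polydisc_radius[of v] assms by blast
  then show ?thesis
    using continuous_on_deriv_series[of r l S] continuous_on_eq_continuous_at[OF open_polydisc] by blast
qed

section \<open>Expansions of both sides in powers of \<open>x\<close>\<close>

lemma deriv_series_diagonal:
  fixes S :: "'k::finite set"
  assumes x: "norm x < R"
  shows "(\<lambda>n. g (n + card S + l) * (of_nat ((n + (CARD('k) + card S - 1)) choose n) * x ^ n))
    sums deriv_series g l S (\<chi> i. x)"
proof -
  define P where "P n = (\<Prod>i\<in>UNIV. power_deriv (i \<in> S) (n i) x)" for n
  define B where "B N = {n :: 'k \<Rightarrow> nat. (\<Sum>i\<in>UNIV. n i) = N}" for N
  define W where "W N = (if N < card S then 0 else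
     of_nat ((CARD('k) + card S + (N - card S) - 1) choose (N - card S)) * x ^ (N - card S))" for N
  have fin: "finite (B N)" for N
    using bij_betw_finite[OF count_bij_betw_multisets_of_size[where 'k = 'k], of N]
    by (simp add: B_def finite_multisets_of_size)
  have "((\<lambda>n. g ((\<Sum>i\<in>UNIV. n i) + l) * P n) has_sum deriv_series g l S (\<chi> i. x)) UNIV"
    unfolding P_def deriv_series_def
    using has_sum_infsum[OF deriv_series_summable[of "\<chi> i. x" l S]] x by simp
  \<comment> \<open>Each multi-index is paired with its total degree, so that the fibres
    \<open>B N\<close> can be summed first.\<close>
  also have "?this \<longleftrightarrow> ((\<lambda>(N, n). g (N + l) * P n) has_sum deriv_series g l S (\<chi> i. x)) (Sigma UNIV B)"
    by (rule has_sum_reindex_bij_witness[of _ snd "\<lambda>n. (\<Sum>i\<in>UNIV. n i, n)"]) (auto simp: B_def)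
  finally have "((\<lambda>N. g (N + l) * W N) has_sum deriv_series g l S (\<chi> i. x)) UNIV"
  proof (rule has_sum_SigmaD)
    fix N
    have "(\<Sum>n\<in>B N. P n) = W N"
      using sum_prod_power_deriv[where N = N and S = S and x = x] by (simp add: B_def P_def W_def)
    then show "((\<lambda>n. case (N, n) of (N, n) \<Rightarrow> g (N + l) * P n) has_sum g (N + l) * W N) (B N)"
      using has_sum_finite[OF fin[of N], of "\<lambda>n. g (N + l) * P n"] by (simp flip: sum_distrib_left)
  qed
  then have "(\<lambda>N. g (N + l) * W N) sums deriv_series g l S (\<chi> i. x)"
    by (rule has_sum_imp_sums)
  \<comment> \<open>In degree below \<open>card S\<close> some differentiated variable has exponent
    0, so these terms vanish and the series may start at \<open>card S\<close>.\<close>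
  moreover have "(\<Sum>N<card S. g (N + l) * W N) = 0"
    by (simp add: W_def)
  ultimately have "(\<lambda>N. g (N + card S + l) * W (N + card S)) sums deriv_series g l S (\<chi> i. x)"
    using sums_iff_shift[of "\<lambda>N. g (N + l) * W N" "card S"] by simp
  moreover have "CARD('k) + card S + N - 1 = N + (CARD('k) + card S - 1)" for N
    using zero_less_card_finite[where 'a = 'k] by linarith
  ultimately show ?thesis
    by (simp add: W_def)
qed

text \<open>With \<open>M = k + j - 1\<close>, taking \<open>M\<close> derivatives and dividing by
  \<open>fact M\<close> multiplies the coefficient of index \<open>n + M\<close> by
  \<open>(n + M) choose n\<close>. The factor \<open>z ^ (k - 1)\<close> makes that coefficient
  \<open>g (n + j + l)\<close>, which matches \<open>deriv_series_diagonal\<close> term by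
  term.\<close>

lemma higher_deriv_power_mult_shift_series:
  assumes x: "norm x < R" and k: "k > 0"
  shows "(\<lambda>n. g (n + j + l) * (of_nat ((n + (k + j - 1)) choose n) * x ^ n)) sums
    ((deriv ^^ (k + j - 1)) (\<lambda>z. z ^ (k - 1) * shift_series g l z) x / fact (k + j - 1))"
proof -
  define G where "G = Abs_fps (\<lambda>n. g (n + l))"
  define f where "f = fps_X ^ (k - 1) * G"
  define M where "M = k + j - 1"
  \<comment> \<open>Shifting the coefficients leaves the radius of convergence unchanged.\<close>
  have "ereal R \<le> fps_conv_radius G"
    unfolding fps_conv_radius_def G_def fps_nth_Abs_fps conv_radius_shift
    by (rule conv_radius_geI_ex') (auto intro!: summable_g)
  then have radius_G: "norm z < fps_conv_radius G" if "norm z < R" for z :: complex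
    using that by (metis less_ereal.simps(1) less_le_trans)
  have radius_f: "norm z < fps_conv_radius f" if "norm z < R" for z :: complex
    using radius_G[OF that] fps_conv_radius_mult[of "fps_X ^ (k - 1)" G] by (simp add: f_def)
  have eval: "z ^ (k - 1) * shift_series g l z = eval_fps f z" if "norm z < R" for z
    using radius_G[OF that]
    by (simp add: f_def eval_fps_mult) (simp add: G_def eval_fps_def shift_series_def)
  have "\<forall>\<^sub>F z in nhds x. z \<in> ball 0 R"
    using x by (intro eventually_nhds_in_open) auto
  then have "\<forall>\<^sub>F z in nhds x. z ^ (k - 1) * shift_series g l z = eval_fps f z"
    by eventually_elim (rule eval, simp)
  then have "(deriv ^^ M) (\<lambda>z. z ^ (k - 1) * shift_series g l z) x = (deriv ^^ M) (eval_fps f) x"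
    by (intro higher_deriv_cong_ev refl)
  also have "\<dots> = eval_fps ((fps_deriv ^^ M) f) x"
    using radius_f[OF x] by (rule higher_deriv_eval_fps)
  finally have "(\<lambda>n. fps_nth ((fps_deriv ^^ M) f) n * x ^ n / fact M) sums
      ((deriv ^^ M) (\<lambda>z. z ^ (k - 1) * shift_series g l z) x / fact M)"
    using sums_eval_fps[OF higher_deriv_eval_fps(1)[OF radius_f[OF x], of M]]
    by (intro sums_divide) simp
  moreover have "fps_nth ((fps_deriv ^^ M) f) n * x ^ n / fact M =
      g (n + j + l) * (of_nat ((n + M) choose n) * x ^ n)" for n
  proof -
    have "fps_nth f (n + M) = g (n + j + l)"
      using k by (cases k) (auto simp: f_def G_def M_def fps_X_power_mult_nth add_ac)
    then show ?thesis
      by (simp add: fps_nth_higher_deriv binomial_fact)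
  qed
  ultimately show ?thesis
    by (simp add: M_def)
qed

end

theorem theorem2:
  fixes g :: "nat \<Rightarrow> complex"
    and R :: real
    and l j k :: nat
    and idx :: "'k::finite list"
    and x :: complex
  assumes "R > 1"
    and "\<And>z. norm z < R \<Longrightarrow> summable (\<lambda>n. g n * z ^ n)"
    and "k = CARD('k)"
    and "1 \<le> j" and "j \<le> k"
    and "length idx = j" and "distinct idx"
    and "norm x < R"
  shows "(iter_partial_deriv idx (multi_series g l :: complex ^ 'k \<Rightarrow> complex) \<longlongrightarrow>
           (deriv ^^ (k + j - 1)) (\<lambda>z. z ^ (k - 1) * shift_series g l z) x / fact (k + j - 1))
         (at (\<chi> i. x))"
proof -
  interpret power_series_on_disc g R
    using assms(1,2) by unfold_locales
  have card: "card (set idx) = j"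
    using assms(6,7) by (simp add: distinct_card)
  \<comment> \<open>Both values are sums of the same series, hence equal.\<close>
  have "deriv_series g l (set idx) (\<chi> i. x) =
      (deriv ^^ (k + j - 1)) (\<lambda>z. z ^ (k - 1) * shift_series g l z) x / fact (k + j - 1)"
    using deriv_series_diagonal[OF assms(8), of "set idx" l]
      higher_deriv_power_mult_shift_series[OF assms(8), of k j l] assms(3)
    by (auto simp: card intro: sums_unique2)
  moreover have "(deriv_series g l (set idx) \<longlongrightarrow> deriv_series g l (set idx) (\<chi> i. x)) (at (\<chi> i. x))"
    using isCont_deriv_series[of "\<chi> i. x" l "set idx"] assms(8) by (simp add: isCont_def)
  \<comment> \<open>The polydisc is a neighbourhood of the diagonal point, so agreement on it is
    enough for the limit.\<close>
  moreover have "\<forall>\<^sub>F v in at (\<chi> i. x). v \<in> {v :: complex ^ 'k. \<forall>i. norm (v $ i) < R}"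
    using assms(8) open_polydisc by (intro eventually_at_in_open') auto
  then have "\<forall>\<^sub>F v in at (\<chi> i. x). iter_partial_deriv idx (multi_series g l) v =
      deriv_series g l (set idx) v"
    by eventually_elim (simp add: iter_partial_deriv_multi_series assms(7))
  ultimately show ?thesis
    by (simp add: tendsto_cong)
qed

end
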